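(* Let $X$ be any topological space. (a) If $X$ has finite cliques, then $X$ is limit point compact. (b) If $X$ is $\omega$-limit point compact (equivalently, countably compact), then $X$ has finite cliques. Hence, for a $T_1$ space $X$, the following are equivalent: $X$ has finite cliques; $X$ is limit point compact; $X$ is countably compact.
   Context: An orthogonality relation on a set $X$ is a symmetric, irreflexive binary relation $R \subseteq X \times X$. For a topological space $X$, $R$ is closed if it is a closed subset of $X \times X$ with the product topology. An $R$-clique is a subset $A \subseteq X$ any two distinct points of which are $R$-related. The space $X$ has finite cliques if for every closed orthogonality relation $R$ on $X$, every $R$-clique is finite. A limit point of $A \subseteq X$ is a point $x \in X$ every open neighborhood of which contains a point of $A$ other than $x$; $X$ is limit point compact if every infinite subset of $X$ has a limit point in $X$. An $\omega$-limit point of $A \subseteq X$ is a point $x \in X$ every open neighborhood of which has infinite intersection with $A$; $X$ is $\omega$-limit point compact if every infinite subset of $X$ has an $\omega$-limit point in $X$. A space is countably compact if every countable open cover has a finite subcover. *)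

theory Defs
  imports "HOL-Analysis.Analysis"
begin

definition orthogonality_relation :: "'a set \<Rightarrow> 'a rel \<Rightarrow> bool" where
  "orthogonality_relation S R \<longleftrightarrow> R \<subseteq> S \<times> S \<and> sym_on S R \<and> irrefl_on S R"

definition closed_orthogonality_relation :: "'a topology \<Rightarrow> 'a rel \<Rightarrow> bool" where
  "closed_orthogonality_relation X R \<longleftrightarrow>
     orthogonality_relation (topspace X) R \<and> closedin (prod_topology X X) R"

definition clique_in :: "'a set \<Rightarrow> 'a rel \<Rightarrow> 'a set \<Rightarrow> bool" where
  "clique_in S R A \<longleftrightarrow> A \<subseteq> S \<and> pairwise (\<lambda>x y. (x, y) \<in> R) A"

definition has_finite_cliques :: "'a topology \<Rightarrow> bool" where
  "has_finite_cliques X \<longleftrightarrow>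
     (\<forall>R. closed_orthogonality_relation X R \<longrightarrow>
        (\<forall>A. clique_in (topspace X) R A \<longrightarrow> finite A))"

(* The set X derived_set_of A consists of the limit points of A in X. *)
definition limit_point_compact_space :: "'a topology \<Rightarrow> bool" where
  "limit_point_compact_space X \<longleftrightarrow>
     (\<forall>A. A \<subseteq> topspace X \<and> infinite A \<longrightarrow> X derived_set_of A \<noteq> {})"

definition omega_limit_point_of :: "'a topology \<Rightarrow> 'a \<Rightarrow> 'a set \<Rightarrow> bool" where
  "omega_limit_point_of X x A \<longleftrightarrow>
     x \<in> topspace X \<and> (\<forall>U. openin X U \<and> x \<in> U \<longrightarrow> infinite (U \<inter> A))"

definition omega_limit_point_compact_space :: "'a topology \<Rightarrow> bool" where
  "omega_limit_point_compact_space X \<longleftrightarrow>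
     (\<forall>A. A \<subseteq> topspace X \<and> infinite A \<longrightarrow> (\<exists>x. omega_limit_point_of X x A))"

(* The library's countably_compact concerns subsets of a type of class topological_space;
   this is the notion for a space given as a value of type 'a topology. *)
definition countably_compact_space :: "'a topology \<Rightarrow> bool" where
  "countably_compact_space X \<longleftrightarrow>
     (\<forall>\<U>. countable \<U> \<and> (\<forall>U\<in>\<U>. openin X U) \<and> \<Union>\<U> = topspace X
        \<longrightarrow> (\<exists>\<V>. finite \<V> \<and> \<V> \<subseteq> \<U> \<and> \<Union>\<V> = topspace X))"

end

theory Submission
  imports Defs
begin

text \<open>
  If an infinite set \<open>A\<close> has no limit point, then the pairs of distinct points of \<open>A\<close> form a
  closed relation, for which \<open>A\<close> is an infinite clique. Conversely, if an \<open>R\<close>-clique \<open>A\<close> has an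
  \<open>\<omega>\<close>-limit point \<open>x\<close>, then every neighbourhood of \<open>x\<close> contains two distinct, hence \<open>R\<close>-related,
  points of \<open>A\<close>, so that \<open>(x, x)\<close> lies in the closure of \<open>R\<close>; a closed irreflexive \<open>R\<close> excludes
  this. In a \<open>T\<^sub>1\<close> space, limit points and \<open>\<omega>\<close>-limit points coincide.
\<close>

lemma closedin_offdiagonal_if_no_limit_points:
  assumes "A \<subseteq> topspace X" "X derived_set_of A = {}"
  shows "closedin (prod_topology X X) {(x, y). x \<in> A \<and> y \<in> A \<and> x \<noteq> y}" (is "closedin _ ?R")
proof -
  have isolating: "\<exists>U. openin X U \<and> x \<in> U \<and> U \<inter> A \<subseteq> {x}" if "x \<in> topspace X" for x
  proof -
    have "x \<notin> X derived_set_of A"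
      using assms(2) by simp
    then show ?thesis
      using that unfolding in_derived_set_of by blast
  qed
  have "\<exists>U V. openin X U \<and> openin X V \<and> x \<in> U \<and> y \<in> V \<and>
          U \<times> V \<subseteq> topspace X \<times> topspace X - ?R"
    if xy: "(x, y) \<in> topspace X \<times> topspace X - ?R" for x y
  proof -
    obtain U where U: "openin X U" "x \<in> U" "U \<inter> A \<subseteq> {x}"
      using isolating xy by blast
    obtain V where V: "openin X V" "y \<in> V" "V \<inter> A \<subseteq> {y}"
      using isolating xy by blast
    \<comment> \<open>A pair of distinct points of \<open>A\<close> inside
      \<open>U \<times> V\<close> could only be \<open>(x, y)\<close> itself, which lies outside the
      relation.\<close>
    have "U \<times> V \<subseteq> topspace X \<times> topspace X - ?R"
      using xy U V openin_subset[OF U(1)] openin_subset[OF V(1)] by blast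
    then show ?thesis using U V by blast
  qed
  then have "openin (prod_topology X X) (topspace X \<times> topspace X - ?R)"
    unfolding openin_prod_topology_alt by blast
  then show ?thesis
    using assms(1) by (auto simp: closedin_def)
qed

lemma limit_point_compact_space_if_has_finite_cliques:
  assumes "has_finite_cliques X"
  shows "limit_point_compact_space X"
  unfolding limit_point_compact_space_def
proof (intro allI impI notI)
  fix A assume A: "A \<subseteq> topspace X \<and> infinite A" and no_limit: "X derived_set_of A = {}"
  let ?R = "{(x, y). x \<in> A \<and> y \<in> A \<and> x \<noteq> y}"
  have "closed_orthogonality_relation X ?R"
    using closedin_offdiagonal_if_no_limit_points[of A X] A no_limit
    unfolding closed_orthogonality_relation_def orthogonality_relation_def sym_on_def irrefl_on_def
    by blast
  moreover have "clique_in (topspace X) ?R A"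
    using A unfolding clique_in_def pairwise_def by blast
  ultimately show False
    using assms A unfolding has_finite_cliques_def by blast
qed

lemma has_finite_cliques_if_omega_limit_point_compact_space:
  assumes "omega_limit_point_compact_space X"
  shows "has_finite_cliques X"
  unfolding has_finite_cliques_def
proof (intro allI impI, rule ccontr)
  fix R A
  assume R: "closed_orthogonality_relation X R" and A: "clique_in (topspace X) R A" "infinite A"
  obtain x where x: "omega_limit_point_of X x A"
    using assms A unfolding omega_limit_point_compact_space_def clique_in_def by blast
  have "openin (prod_topology X X) (topspace X \<times> topspace X - R)"
    using R unfolding closed_orthogonality_relation_def closedin_def by simp
  moreover have "(x, x) \<in> topspace X \<times> topspace X - R"
    using x R unfolding omega_limit_point_of_def closed_orthogonality_relation_def
      orthogonality_relation_def irrefl_on_def by blast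
  ultimately obtain U V where UV: "openin X U" "openin X V" "x \<in> U" "x \<in> V"
    "U \<times> V \<subseteq> topspace X \<times> topspace X - R"
    unfolding openin_prod_topology_alt by meson
  \<comment> \<open>Intersecting the two factors gives a single neighbourhood of \<open>x\<close>,
    so two distinct points of its trace on \<open>A\<close> form a pair in
    \<open>U \<times> V\<close>. A mere limit point would guarantee only one point besides
    \<open>x\<close>.\<close>
  have inf: "infinite (U \<inter> V \<inter> A)"
    using x UV openin_Int[OF UV(1,2)] unfolding omega_limit_point_of_def by blast
  then obtain a where a: "a \<in> U \<inter> V \<inter> A"
    using infinite_imp_nonempty by blast
  have "infinite (U \<inter> V \<inter> A - {a})"
    using inf by simp
  then obtain b where b: "b \<in> U \<inter> V \<inter> A" "b \<noteq> a"
    using infinite_imp_nonempty by blast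
  have "(a, b) \<in> R"
    using A(1) a b pairwiseD[of "\<lambda>x y. (x, y) \<in> R" A a b] unfolding clique_in_def by simp
  moreover have "(a, b) \<in> U \<times> V"
    using a b by simp
  ultimately show False using UV(5) by (metis DiffD2 subsetD)
qed

text \<open>Without a finite subcover, \<open>s n\<close> can be chosen outside \<open>u 0\<close>,
  ..., \<open>u n\<close>, so \<open>u m\<close> contains \<open>s n\<close> only for
  \<open>n < m\<close>. The \<open>u m\<close> cover the space and each meets \<open>range s\<close>
  in a finite set, so the infinite set \<open>range s\<close> has no omega-limit point.\<close>

lemma countably_compact_space_if_omega_limit_point_compact_space:
  assumes "omega_limit_point_compact_space X"
  shows "countably_compact_space X"
  unfolding countably_compact_space_def
proof (intro allI impI, rule ccontr)
  fix \<U> assume \<U>: "countable \<U> \<and> (\<forall>U\<in>\<U>. openin X U) \<and> \<Union>\<U> = topspace X"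
    and no_subcover: "\<nexists>\<V>. finite \<V> \<and> \<V> \<subseteq> \<U> \<and> \<Union>\<V> = topspace X"
  have "\<U> \<noteq> {}"
  proof
    assume "\<U> = {}"
    then have "finite \<U> \<and> \<U> \<subseteq> \<U> \<and> \<Union>\<U> = topspace X"
      using \<U> by simp
    then show False using no_subcover by metis
  qed
  \<comment> \<open>Nonemptiness lets \<open>from_nat_into\<close> enumerate exactly the cover; a
    finite cover is enumerated with repetitions.\<close>
  then have range: "range (from_nat_into \<U>) = \<U>"
    using \<U> by (simp add: range_from_nat_into)
  define u where "u = from_nat_into \<U>"
  have "\<exists>x. x \<in> topspace X - (\<Union>k\<le>n. u k)" for n
  proof -
    have sub: "u ` {..n} \<subseteq> \<U>"
      using range unfolding u_def by blast
    then have "\<Union>(u ` {..n}) \<noteq> topspace X"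
      using no_subcover finite_imageI[OF finite_atMost[of n], of u] by metis
    moreover have "\<Union>(u ` {..n}) \<subseteq> topspace X"
      using Union_mono[OF sub] \<U> by simp
    ultimately show ?thesis by blast
  qed
  then obtain s where s: "\<And>n. s n \<in> topspace X - (\<Union>k\<le>n. u k)"
    by metis
  have early: "n < m" if "s n \<in> u m" for n m
    using s[of n] that not_le by auto
  have cover: "\<exists>m. y \<in> u m" if "y \<in> topspace X" for y
    using that \<U> range unfolding u_def by (metis UnionE imageE)
  \<comment> \<open>The sequence may repeat values, but none infinitely often: a value lying in
    \<open>u m\<close> is taken only at indices below \<open>m\<close>.\<close>
  have "infinite (range s)"
  proof
    assume "finite (range s)"
    then obtain n0 where "infinite {n. s n = s n0}"
      using pigeonhole_infinite[of UNIV s] by auto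
    moreover obtain m where "s n0 \<in> u m"
      using cover s by blast
    then have "{n. s n = s n0} \<subseteq> {..<m}"
      using early by force
    ultimately show False
      using finite_subset by blast
  qed
  then obtain x where x: "omega_limit_point_of X x (range s)"
    using assms s unfolding omega_limit_point_compact_space_def by blast
  then obtain m where m: "x \<in> u m"
    using cover unfolding omega_limit_point_of_def by blast
  have "openin X (u m)"
    using \<U> range unfolding u_def by blast
  then have "infinite (u m \<inter> range s)"
    using x m unfolding omega_limit_point_of_def by blast
  moreover have "u m \<inter> range s \<subseteq> s ` {..<m}"
    using early by blast
  ultimately show False
    using finite_subset by blast
qed

lemma omega_limit_point_compact_space_if_countably_compact_space:
  assumes "countably_compact_space X"
  shows "omega_limit_point_compact_space X"
  unfolding omega_limit_point_compact_space_def
proof (intro allI impI, rule ccontr)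
  fix A assume A: "A \<subseteq> topspace X \<and> infinite A" and no_limit: "\<nexists>x. omega_limit_point_of X x A"
  \<comment> \<open>A countable \<open>B\<close> has only countably many finite subsets, and it
    inherits from \<open>A\<close> the absence of omega-limit points.\<close>
  obtain B where B: "B \<subseteq> A" "infinite B" "countable B"
    using A infinite_countable_subset' by blast
  have isolating: "\<exists>U. openin X U \<and> x \<in> U \<and> finite (U \<inter> B)" if "x \<in> topspace X" for x
    using no_limit that B(1) unfolding omega_limit_point_of_def
    by (meson finite_subset inf_mono order_refl)
  \<comment> \<open>Grouping the isolating neighbourhoods by their finite trace on \<open>B\<close> makes the cover countable.\<close>
  define W where "W F = \<Union>{U. openin X U \<and> U \<inter> B \<subseteq> F}" for F
  define \<F> where "\<F> = {F. finite F \<and> F \<subseteq> B}"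
  have "countable (W ` \<F>)"
    using B(3) unfolding \<F>_def by (simp add: countable_Collect_finite_subset)
  moreover have op: "openin X (W F)" for F
    unfolding W_def by blast
  moreover have "\<Union>(W ` \<F>) = topspace X"
  proof
    show "\<Union>(W ` \<F>) \<subseteq> topspace X"
      using op openin_subset by blast
    show "topspace X \<subseteq> \<Union>(W ` \<F>)"
    proof
      fix x assume "x \<in> topspace X"
      then obtain U where "openin X U" "x \<in> U" "finite (U \<inter> B)"
        using isolating by blast
      then have "x \<in> W (U \<inter> B)" "U \<inter> B \<in> \<F>"
        unfolding W_def \<F>_def by auto
      then show "x \<in> \<Union>(W ` \<F>)" by blast
    qed
  qed
  ultimately obtain \<V> where \<V>: "finite \<V>" "\<V> \<subseteq> W ` \<F>" "\<Union>\<V> = topspace X"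
    using assms unfolding countably_compact_space_def by (metis (no_types, lifting) imageE)
  \<comment> \<open>\<open>W F\<close> meets \<open>B\<close> only inside \<open>F\<close>, so
    finitely many members of the cover capture only finitely many points of
    \<open>B\<close>.\<close>
  have "finite (V \<inter> B)" if V: "V \<in> \<V>" for V
  proof -
    obtain F where "F \<in> \<F>" "V = W F"
      using V \<V>(2) by blast
    then have "V \<inter> B \<subseteq> F" "finite F"
      unfolding W_def \<F>_def by auto
    then show ?thesis by (rule finite_subset)
  qed
  then have "finite (\<Union>V\<in>\<V>. V \<inter> B)"
    using \<V>(1) by blast
  moreover have "B = (\<Union>V\<in>\<V>. V \<inter> B)"
    using \<V>(3) A B(1) by blast
  ultimately show False using B(2) by simp
qed

text \<open>Finite sets are closed in a \<open>T\<^sub>1\<close> space, so a neighbourhood of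
  \<open>x\<close> with finite trace on \<open>A\<close> shrinks to one that avoids all points of
  \<open>A\<close> other than \<open>x\<close>. At a limit point this is impossible.\<close>

lemma omega_limit_point_compact_space_if_t1_space:
  assumes "t1_space X" "limit_point_compact_space X"
  shows "omega_limit_point_compact_space X"
  unfolding omega_limit_point_compact_space_def
proof (intro allI impI)
  fix A assume "A \<subseteq> topspace X \<and> infinite A"
  then obtain x where "x \<in> X derived_set_of A"
    using assms(2) unfolding limit_point_compact_space_def by blast
  then have "omega_limit_point_of X x A"
    using assms(1)
    by (auto simp: omega_limit_point_of_def t1_space_derived_set_of_infinite_openin Int_commute)
  then show "\<exists>x. omega_limit_point_of X x A" ..
qed

theorem lemma2:
  fixes X :: "'a topology"
  shows "(has_finite_cliques X \<longrightarrow> limit_point_compact_space X) \<and>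
         (omega_limit_point_compact_space X \<longleftrightarrow> countably_compact_space X) \<and>
         (omega_limit_point_compact_space X \<longrightarrow> has_finite_cliques X) \<and>
         (t1_space X \<longrightarrow>
            (has_finite_cliques X \<longleftrightarrow> limit_point_compact_space X) \<and>
            (limit_point_compact_space X \<longleftrightarrow> countably_compact_space X))"
  \<comment> \<open>For a \<open>T\<^sub>1\<close> space the implications close a cycle: finite
    cliques, limit point compact, omega-limit point compact, finite cliques.\<close>
  using limit_point_compact_space_if_has_finite_cliques[of X]
    has_finite_cliques_if_omega_limit_point_compact_space[of X]
    countably_compact_space_if_omega_limit_point_compact_space[of X]
    omega_limit_point_compact_space_if_countably_compact_space[of X]
    omega_limit_point_compact_space_if_t1_space[of X]
  by blast

end
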